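(* Let $(T,d)$ be a metric space and $m$ a Borel probability measure on $T$ with $\operatorname{supp}(m)=T$. Let $a,b\ge0$, $\varphi\in\mathcal{G}_{a,b}$ and $R\ge 2$; put $A=\frac{R^3}{(R-1)(R-2)}$, $B=\frac{R^2}{R-1}$ and $K=(aA+bB)\,\mathcal{S}$. Let $\psi:\mathbb{R}_+\to\mathbb{R}$ be an increasing, continuous function with $\psi(0)=0$, and let $\alpha,\beta\ge0$ be such that $$\psi(x)\le\alpha+\beta\frac{\varphi(xy)}{\varphi(y)}\qquad\text{for all }x\ge0,\ y>0.$$ Then for each separable real-valued stochastic process $X(t)$, $t\in T$, which satisfies $$\sup_{s,t\in T}\mathbf{E}\,\varphi\left(\frac{|X(s)-X(t)|}{d(s,t)}\right)\le 1,$$ the following inequality holds: $$\mathbf{E}\sup_{s,t\in T}\psi\left(\frac{|X(s)-X(t)|}{2K}\right)\le\alpha+\beta.$$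
   Context: $B(x,\varepsilon)=\{y\in T:d(x,y)\le\varepsilon\}$ is the closed ball and $D(T)=\sup\{d(s,t):s,t\in T\}$ the diameter of $T$ (possibly $+\infty$). For $a,b\ge0$, $\mathcal{G}_{a,b}$ is the class of all functions $\varphi:\mathbb{R}_+\to\mathbb{R}$ that are (strictly) increasing and continuous, satisfy $\varphi(0)=0$, and satisfy $x\le a+b\frac{\varphi(xy)}{\varphi(y)}$ for all $x\ge 0$, $y\ge\varphi^{-1}(1)$; it is understood that the inverse $\varphi^{-1}$ is defined on $[0,\infty)$. Define $\mathcal{S}=\sup_{x\in T}\int_0^{D(T)}\varphi^{-1}\left(\frac{1}{m(B(x,\varepsilon))}\right)d\varepsilon\in[0,\infty]$. Conventions: $0/0=0$ (so the terms with $s=t$ contribute $0$); for $R=2$, $A=+\infty$; $0\cdot\infty=0$; and a finite number divided by $+\infty$ is $0$. For a separable process, expectations of suprema over $T$ are understood as suprema over finite subsets: $\mathbf{E}\sup_{s,t\in T}\psi(|X(s)-X(t)|/(2K)):=\sup_{F\subset T,\ F\text{ finite}}\mathbf{E}\sup_{s,t\in F}\psi(|X(s)-X(t)|/(2K))$. *)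

theory Defs
  imports "HOL-Probability.Probability"
begin

text \<open>The library constant \<open>diameter\<close> is real-valued and meaningless on unbounded sets.\<close>

definition ediameter :: "'a::metric_space set \<Rightarrow> ennreal" where
  "ediameter S = (SUP s\<in>S. SUP t\<in>S. ennreal (dist s t))"

definition measure_support :: "'a::topological_space measure \<Rightarrow> 'a set" where
  "measure_support m = {x. \<forall>U. open U \<longrightarrow> x \<in> U \<longrightarrow> emeasure m U > 0}"

text \<open>Functions on \<open>[0,\<infinity>)\<close> are total functions of which only the restriction to
  \<open>{0..}\<close> matters.\<close>

definition inv_Rplus :: "(real \<Rightarrow> real) \<Rightarrow> real \<Rightarrow> real" where
  "inv_Rplus \<phi> = the_inv_into {0..} \<phi>"

text \<open>The image condition says that the inverse is defined on all of \<open>[0,\<infinity>)\<close>.\<close>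

definition growth_class :: "real \<Rightarrow> real \<Rightarrow> (real \<Rightarrow> real) set" where
  "growth_class a b = {\<phi>.
     strict_mono_on {0..} \<phi> \<and> continuous_on {0..} \<phi> \<and> \<phi> 0 = 0 \<and> \<phi> ` {0..} = {0..} \<and>
     (\<forall>x\<ge>0. \<forall>y\<ge>inv_Rplus \<phi> 1. x \<le> a + b * (\<phi> (x * y) / \<phi> y))}"

definition majorizing_integral :: "(real \<Rightarrow> real) \<Rightarrow> 'a::metric_space measure \<Rightarrow> ennreal" where
  "majorizing_integral \<phi> m =
     (SUP x. \<integral>\<^sup>+\<epsilon>\<in>{\<epsilon>. 0 < \<epsilon> \<and> ennreal \<epsilon> < ediameter (UNIV :: 'a set)}.
        ennreal (inv_Rplus \<phi> (1 / measure m (cball x \<epsilon>))) \<partial>lborel)"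

text \<open>Separability in the sense of Doob: outside a null set, every value is a limit of values
  at nearby points of a fixed countable set.\<close>

definition separable_process ::
    "'w measure \<Rightarrow> ('a::topological_space \<Rightarrow> 'w \<Rightarrow> real) \<Rightarrow> bool" where
  "separable_process M X \<longleftrightarrow>
     (\<exists>Q. countable Q \<and>
        (AE \<omega> in M. \<forall>t U. open U \<longrightarrow> t \<in> U \<longrightarrow> X t \<omega> \<in> closure ((\<lambda>s. X s \<omega>) ` (Q \<inter> U))))"

end

theory Submission imports Defs begin

text \<open>
  Put \<open>Y k = \<phi>\<inverse>(1) R^k\<close> and let \<open>r k x\<close> be the least radius with \<open>m (cball x (r k x)) \<ge> 1 / \<phi> (Y k)\<close>.
  The functions \<open>r k\<close> are 1-Lipschitz and \<open>\<Sum>k. Y (k + 1) * r k x \<le> R\<^sup>2 / (R - 1) * \<S>\<close>. Averaging a function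
  over the balls of radius \<open>r n x\<close>, then \<open>r (n - 1)\<close>, and so on down to \<open>r 0\<close>, whose ball is the whole space,
  telescopes \<open>f x\<close> minus its mean into differences \<open>f u - f v\<close> with \<open>dist u v \<le> r k u\<close>. Each of them
  is bounded by the growth condition at \<open>y = Y (k + 1)\<close>: the constant part adds up to \<open>a A \<S>\<close>, and the
  other part to \<open>b B \<S>\<close> times an average of \<open>\<phi> (\<bar>f u - f v\<bar> / dist u v)\<close> against a probability
  measure on pairs that does not depend on \<open>f\<close>. Up to an arbitrarily small error this measure can be
  chosen with finite support. Applying the resulting inequality to a rescaled path of \<open>X\<close>, using the
  condition that links \<open>\<psi>\<close> and \<open>\<phi>\<close>, and taking expectations gives the theorem.
\<close>

subsection \<open>Chaining along averaging kernels\<close>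

text \<open>For \<open>u = v\<close> the quotient has denominator 0 and HOL division returns 0, in
  line with the convention 0/0 = 0.\<close>

definition increment :: "(real \<Rightarrow> real) \<Rightarrow> ('a::metric_space \<Rightarrow> real) \<Rightarrow> 'a \<times> 'a \<Rightarrow> real" where
  "increment \<phi> f q = \<phi> (\<bar>f (fst q) - f (snd q)\<bar> / dist (fst q) (snd q))"

text \<open>The coefficient of the finest radius after \<open>n\<close> averaging steps: each further average over a ball
  of radius \<open>\<rho> (n + 1)\<close> moves the sum of all previous coefficients, which is \<open>2 * top_coeff Y n\<close>, onto
  \<open>\<rho> (n + 1)\<close>.\<close>

primrec top_coeff :: "(nat \<Rightarrow> real) \<Rightarrow> nat \<Rightarrow> real" where
  "top_coeff Y 0 = 0"
| "top_coeff Y (Suc n) = 2 * top_coeff Y n + Y (Suc n)"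

text \<open>In \<open>avg_deviation\<close> the coarser radii together carry the same total
  coefficient as the finest one; this is what produces the doubling in the recursion.\<close>

lemma sum_top_coeff: "(\<Sum>j<n. top_coeff Y j + Y (Suc j)) = top_coeff Y n"
  by (induction n) auto

lemma top_coeff_nonneg: "(\<And>k. 0 \<le> Y k) \<Longrightarrow> 0 \<le> top_coeff Y n"
  by (induction n) auto

text \<open>The recursion only doubles while \<open>Y\<close> grows by the factor
  \<open>R > 2\<close>, and \<open>2 / (R - 2) + 1 = R / (R - 2)\<close>. The denominator
  \<open>R - 2\<close> in the constant of the theorem originates here.\<close>

lemma top_coeff_le:
  assumes "R > 2" "\<And>k. 0 \<le> Y k" "\<And>k. Y (Suc k) = R * Y k"
  shows "top_coeff Y n \<le> Y (Suc n) / (R - 2)"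
proof (induction n)
  case 0
  then show ?case using assms(1) assms(2)[of "Suc 0"] by simp
next
  case (Suc n)
  have "top_coeff Y (Suc n) \<le> 2 * (Y (Suc n) / (R - 2)) + Y (Suc n)"
    using Suc by simp
  also have "\<dots> = Y (Suc (Suc n)) / (R - 2)"
    using assms(1) assms(3)[of "Suc n"] by (simp add: field_simps)
  finally show ?case .
qed

text \<open>A finite model of the balls: \<open>P\<close> labels the cells of a partition,
  \<open>\<mu>\<close> gives their masses, and \<open>\<kappa> k x\<close> is the normalized measure
  on a ball around \<open>x\<close> of mass at least \<open>1 / \<phi> (Y k)\<close>. That mass
  bound becomes \<open>kappa_le\<close>; \<open>kappa_0\<close> reflects that the coarsest ball has
  full mass.\<close>

locale chaining_kernels =
  fixes \<phi> :: "real \<Rightarrow> real" and a b :: real and Y :: "nat \<Rightarrow> real"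
    and P :: "'a::metric_space set" and \<mu> :: "'a \<Rightarrow> real"
    and \<rho> :: "nat \<Rightarrow> 'a \<Rightarrow> real" and \<kappa> :: "nat \<Rightarrow> 'a \<Rightarrow> 'a \<Rightarrow> real"
  assumes ab: "0 \<le> a" "0 \<le> b"
    and phi_nonneg: "\<And>x. 0 \<le> x \<Longrightarrow> 0 \<le> \<phi> x"
    and growth: "\<And>x k. 0 \<le> x \<Longrightarrow> x \<le> a + b * (\<phi> (x * Y k) / \<phi> (Y k))"
    and Y_pos: "\<And>k. 0 < Y k"
    and phi_Y: "\<And>k. 1 \<le> \<phi> (Y k)"
    and fin: "finite P"
    and mu_nonneg: "\<And>u. 0 \<le> \<mu> u"
    and rho_nonneg: "\<And>k x. 0 \<le> \<rho> k x"
    and rho_lipschitz: "\<And>k x y. \<rho> k x \<le> \<rho> k y + dist x y"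
    and kappa_nonneg: "\<And>k x v. 0 \<le> \<kappa> k x v"
    and kappa_sum: "\<And>k x. (\<Sum>v\<in>P. \<kappa> k x v) = 1"
    and kappa_local: "\<And>k x v. v \<in> P \<Longrightarrow> \<kappa> k x v \<noteq> 0 \<Longrightarrow> dist x v \<le> \<rho> k x"
    and kappa_le: "\<And>k x v. v \<in> P \<Longrightarrow> \<kappa> k x v \<le> \<phi> (Y k) * \<mu> v"
    and kappa_0: "\<And>x v. v \<in> P \<Longrightarrow> \<kappa> 0 x v = \<mu> v"
begin

section \<open>Averages with respect to the kernels\<close>

definition avg :: "nat \<Rightarrow> ('a \<Rightarrow> real) \<Rightarrow> 'a \<Rightarrow> real" where
  "avg k g x = (\<Sum>v\<in>P. \<kappa> k x v * g v)"

definition mean :: "('a \<Rightarrow> real) \<Rightarrow> real" where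
  "mean g = (\<Sum>v\<in>P. \<mu> v * g v)"

lemma avg_mono:
  assumes "\<And>v. v \<in> P \<Longrightarrow> dist x v \<le> \<rho> k x \<Longrightarrow> g v \<le> h v"
  shows "avg k g x \<le> avg k h x"
  unfolding avg_def
proof (rule sum_mono)
  fix v assume "v \<in> P"
  then show "\<kappa> k x v * g v \<le> \<kappa> k x v * h v"
    using kappa_local[of v k x] assms kappa_nonneg by (cases "\<kappa> k x v = 0") (auto intro: mult_left_mono)
qed

lemma avg_affine: "avg k (\<lambda>v. c + d * g v) x = c + d * avg k g x"
proof -
  have "avg k (\<lambda>v. c + d * g v) x = (\<Sum>v\<in>P. c * \<kappa> k x v + d * (\<kappa> k x v * g v))"
    unfolding avg_def by (intro sum.cong) (auto simp: algebra_simps)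
  then show ?thesis
    by (simp add: sum.distrib sum_distrib_left[symmetric] kappa_sum avg_def)
qed

lemma avg_diff: "avg k (\<lambda>v. g v - h v) x = avg k g x - avg k h x"
  unfolding avg_def by (simp add: algebra_simps sum_subtractf)

lemma avg_const: "avg k (\<lambda>v. c) x = c"
  using avg_affine[of k c 0] by simp

lemma avg_abs: "\<bar>avg k g x\<bar> \<le> avg k (\<lambda>v. \<bar>g v\<bar>) x"
proof -
  have "\<bar>avg k g x\<bar> \<le> (\<Sum>v\<in>P. \<bar>\<kappa> k x v * g v\<bar>)"
    unfolding avg_def by (rule sum_abs)
  then show ?thesis
    by (simp add: avg_def abs_mult kappa_nonneg)
qed

lemma avg_nonneg: "(\<And>v. v \<in> P \<Longrightarrow> 0 \<le> g v) \<Longrightarrow> 0 \<le> avg k g x"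
  unfolding avg_def by (intro sum_nonneg mult_nonneg_nonneg kappa_nonneg)

lemma avg_0: "avg 0 g x = mean g"
  unfolding avg_def mean_def by (simp add: kappa_0)

text \<open>Replaces an average around \<open>x\<close> by one that does not depend on
  \<open>x\<close>. The price \<open>\<phi> (Y k)\<close> later cancels the denominator of the
  growth bound.\<close>

lemma avg_le_mean:
  assumes "\<And>v. v \<in> P \<Longrightarrow> 0 \<le> g v"
  shows "avg k g x \<le> \<phi> (Y k) * mean g"
proof -
  have "avg k g x \<le> (\<Sum>v\<in>P. (\<phi> (Y k) * \<mu> v) * g v)"
    unfolding avg_def using assms kappa_le by (intro sum_mono mult_right_mono) auto
  then show ?thesis by (simp add: mean_def sum_distrib_left mult.assoc)
qed

lemma increment_nonneg: "0 \<le> increment \<phi> f q"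
  unfolding increment_def by (intro phi_nonneg) auto

text \<open>With \<open>z\<close> the difference quotient, growth is applied to
  \<open>z / Y j\<close> at scale \<open>Y j\<close>, so that the argument of \<open>\<phi>\<close>
  becomes \<open>z\<close> itself. The scale \<open>j\<close> is independent of \<open>n\<close>
  because chaining pairs radius \<open>n\<close> with scale \<open>n + 1\<close>.\<close>

lemma abs_diff_le_increment:
  assumes "dist u v \<le> \<rho> n u"
  shows "\<bar>f u - f v\<bar> \<le> \<rho> n u * Y j * (a + b / \<phi> (Y j) * increment \<phi> f (u, v))"
proof (cases "u = v")
  case True
  then show ?thesis
    using ab rho_nonneg[of n v] less_imp_le[OF Y_pos[of j]] phi_Y[of j] increment_nonneg[of f]
    by (auto intro!: mult_nonneg_nonneg add_nonneg_nonneg divide_nonneg_nonneg)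
next
  case False
  define z where "z = \<bar>f u - f v\<bar> / dist u v"
  have d: "dist u v > 0" using False by simp
  have "z / Y j \<le> a + b * (\<phi> (z / Y j * Y j) / \<phi> (Y j))"
    using Y_pos[of j] d by (intro growth) (auto simp: z_def)
  then have "z / Y j \<le> a + b / \<phi> (Y j) * increment \<phi> f (u, v)"
    using Y_pos[of j] by (simp add: increment_def z_def)
  then have *: "z \<le> Y j * (a + b / \<phi> (Y j) * increment \<phi> f (u, v))"
    using Y_pos[of j] by (simp add: field_simps)
  have "\<bar>f u - f v\<bar> = dist u v * z" using d by (simp add: z_def)
  also have "\<dots> \<le> \<rho> n u * (Y j * (a + b / \<phi> (Y j) * increment \<phi> f (u, v)))"
    using assms * d by (intro mult_mono) (auto simp: rho_nonneg z_def)
  finally show ?thesis by (simp add: mult.assoc)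
qed

lemma abs_diff_avg_le:
  "\<bar>f u - avg n f u\<bar> \<le> \<rho> n u * Y j * (a + b / \<phi> (Y j) * avg n (\<lambda>v. increment \<phi> f (u, v)) u)"
proof -
  have "f u - avg n f u = avg n (\<lambda>v. f u - f v) u"
    by (simp add: avg_diff avg_const)
  then have "\<bar>f u - avg n f u\<bar> \<le> avg n (\<lambda>v. \<bar>f u - f v\<bar>) u"
    using avg_abs by metis
  also have "\<dots> \<le> avg n (\<lambda>v. \<rho> n u * Y j * a + \<rho> n u * Y j * (b / \<phi> (Y j)) * increment \<phi> f (u, v)) u"
    using abs_diff_le_increment[of u _ n f j] by (intro avg_mono) (simp add: algebra_simps)
  also have "\<dots> = \<rho> n u * Y j * (a + b / \<phi> (Y j) * avg n (\<lambda>v. increment \<phi> f (u, v)) u)"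
    unfolding avg_affine by (simp add: algebra_simps)
  finally show ?thesis .
qed

text \<open>No starting point enters: \<open>u\<close> is weighted by \<open>\<mu>\<close> and
  \<open>v\<close> by \<open>\<kappa> k u\<close>. Hence this is a combination of increments whose
  nonnegative weights are the same for every \<open>f\<close>.\<close>

definition energy :: "nat \<Rightarrow> ('a \<Rightarrow> real) \<Rightarrow> real" where
  "energy k f = mean (\<lambda>u. \<rho> k u * avg k (\<lambda>v. increment \<phi> f (u, v)) u)"

text \<open>The bound \<open>\<kappa> k x v \<le> \<phi> (Y k) * \<mu> v\<close> turns the increment part of the error into a
  term that does not depend on \<open>x\<close>, so that further averaging leaves it unchanged. The radii in the
  other part grow under averaging, but only linearly because they are Lipschitz.\<close>

lemma avg_deviation:
  "\<bar>avg n f x - mean f\<bar> \<le>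
     a * (\<Sum>j<n. (top_coeff Y j + Y (Suc j)) * \<rho> j x) + a * top_coeff Y n * \<rho> n x
     + b * (\<Sum>k<n. Y (Suc k) * energy k f)"
proof (induction n arbitrary: x)
  case 0
  then show ?case by (simp add: avg_0)
next
  case (Suc n)
  let ?t = "top_coeff Y"
  let ?W = "\<Sum>k<n. Y (Suc k) * energy k f"
  let ?Y = "Y (Suc n)"
  let ?G = "\<lambda>u. \<rho> n u * avg n (\<lambda>v. increment \<phi> f (u, v)) u"
  let ?r = "\<rho> (Suc n) x"
  let ?c = "a * ?Y * (\<rho> n x + ?r) + a * (\<Sum>j<n. (?t j + Y (Suc j)) * (\<rho> j x + ?r))
      + a * ?t n * (\<rho> n x + ?r) + b * ?W"
  have t0: "0 \<le> ?t j" and Y0: "0 \<le> Y j" for j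
    using Y_pos by (auto intro!: top_coeff_nonneg simp: less_imp_le)
  \<comment> \<open>The induction hypothesis is used at each \<open>u\<close> in the next ball
    around \<open>x\<close>; the Lipschitz property then moves all radii from \<open>u\<close> back
    to \<open>x\<close> at the cost \<open>?r\<close> each.\<close>
  have point: "\<bar>f u - mean f\<bar> \<le> ?c + b * ?Y / \<phi> ?Y * ?G u" if "dist x u \<le> ?r" for u
  proof -
    have lip: "\<rho> j u \<le> \<rho> j x + ?r" for j
      using rho_lipschitz[of j u x] that by (simp add: dist_commute)
    have "\<bar>f u - mean f\<bar> \<le> \<bar>f u - avg n f u\<bar> + \<bar>avg n f u - mean f\<bar>" by simp
    \<comment> \<open>Scale \<open>Suc n\<close> is chosen so that the factor
      \<open>1 / \<phi> (Y (Suc n))\<close> cancels exactly the cost of averaging at scale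
      \<open>Suc n\<close> below.\<close>
    also have "\<bar>f u - avg n f u\<bar> \<le> a * ?Y * \<rho> n u + b * ?Y / \<phi> ?Y * ?G u"
      using abs_diff_avg_le[of f u n "Suc n"] by (simp add: algebra_simps)
    also have "a * ?Y * \<rho> n u \<le> a * ?Y * (\<rho> n x + ?r)"
      using lip ab Y0 by (intro mult_left_mono) auto
    also have "\<bar>avg n f u - mean f\<bar> \<le> a * (\<Sum>j<n. (?t j + Y (Suc j)) * \<rho> j u) + a * ?t n * \<rho> n u + b * ?W"
      by (rule Suc)
    also have "a * (\<Sum>j<n. (?t j + Y (Suc j)) * \<rho> j u) \<le> a * (\<Sum>j<n. (?t j + Y (Suc j)) * (\<rho> j x + ?r))"
      using lip ab t0 Y0 by (intro mult_left_mono sum_mono) auto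
    also have "a * ?t n * \<rho> n u \<le> a * ?t n * (\<rho> n x + ?r)"
      using lip ab t0 by (intro mult_left_mono) auto
    finally show ?thesis by simp
  qed
  have "avg (Suc n) f x - mean f = avg (Suc n) (\<lambda>u. f u - mean f) x"
    by (simp add: avg_diff avg_const)
  then have "\<bar>avg (Suc n) f x - mean f\<bar> \<le> avg (Suc n) (\<lambda>u. \<bar>f u - mean f\<bar>) x"
    using avg_abs by metis
  also have "\<dots> \<le> avg (Suc n) (\<lambda>u. ?c + b * ?Y / \<phi> ?Y * ?G u) x"
    by (intro avg_mono point)
  also have "\<dots> = ?c + b * ?Y / \<phi> ?Y * avg (Suc n) ?G x"
    by (rule avg_affine)
  also have "\<dots> \<le> ?c + b * ?Y / \<phi> ?Y * (\<phi> ?Y * energy n f)"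
    unfolding energy_def using ab Y0[of "Suc n"] phi_Y[of "Suc n"]
    by (intro add_left_mono mult_left_mono avg_le_mean)
      (auto intro!: mult_nonneg_nonneg rho_nonneg avg_nonneg increment_nonneg)
  also have "b * ?Y / \<phi> ?Y * (\<phi> ?Y * energy n f) = b * (?Y * energy n f)"
    using phi_Y[of "Suc n"] by auto
  also have "(\<Sum>j<n. (?t j + Y (Suc j)) * (\<rho> j x + ?r)) =
      (\<Sum>j<n. (?t j + Y (Suc j)) * \<rho> j x) + ?t n * ?r"
    by (simp add: distrib_left sum.distrib sum_distrib_right[symmetric]
      sum_top_coeff[unfolded sum.distrib])
  finally show ?case by (simp add: algebra_simps)
qed

text \<open>Comparing \<open>f s\<close> and \<open>f t\<close> with the common mean yields the
  factor 1/2. The energies supply weights on pairs from \<open>P\<close>. The last link, from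
  \<open>s\<close> to its finest average, starts at a prescribed point and gets its own weight
  \<open>e * \<kappa> n s\<close>; over all of \<open>F\<close> these add up to
  \<open>card F * e\<close>.\<close>

lemma finite_pair_bound:
  fixes R C e :: real
  assumes R: "R \<ge> 2" "a = 0 \<or> R > 2" and YR: "\<And>k. Y (Suc k) = R * Y k"
    and F: "finite F"
    and C: "\<And>x. (\<Sum>k\<le>n. Y (Suc k) * \<rho> k x) \<le> C"
    and e: "\<forall>x\<in>F. Y (Suc n) * \<rho> n x \<le> e" "0 \<le> e"
  shows "\<exists>Q w. finite Q \<and> (\<forall>q. 0 \<le> w q) \<and> sum w Q \<le> b * (C + card F * e) \<and>
    (\<forall>f. \<forall>s\<in>F. \<forall>t\<in>F. \<bar>f s - f t\<bar> / 2 \<le>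
       a * ((R - 1) / (R - 2) * C + e) + (\<Sum>q\<in>Q. w q * increment \<phi> f q))"
proof -
  define Q where "Q = (P \<union> F) \<times> P"
  define w where "w = (\<lambda>(u, v). b * ((if u \<in> P then \<Sum>k<n. Y (Suc k) * (\<mu> u * (\<rho> k u * \<kappa> k u v)) else 0)
     + (if u \<in> F then e * \<kappa> n u v else 0)))"
  have Y0: "0 \<le> Y j" for j
    using Y_pos by (auto intro!: less_imp_le)
  have w0: "0 \<le> w q" for q
    using ab e(2) Y0 mu_nonneg rho_nonneg kappa_nonneg
    by (auto simp: w_def split: prod.split intro!: mult_nonneg_nonneg add_nonneg_nonneg sum_nonneg)
  \<comment> \<open>Kept for general \<open>g\<close>: the constant 1 gives the mass of
    \<open>w\<close>, and \<open>increment\<close> gives the energies together with the last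
    links.\<close>
  have sum_w: "(\<Sum>q\<in>Q. w q * g q) =
      b * ((\<Sum>k<n. Y (Suc k) * mean (\<lambda>u. \<rho> k u * avg k (\<lambda>v. g (u, v)) u))
         + (\<Sum>u\<in>F. e * avg n (\<lambda>v. g (u, v)) u))" for g
  proof -
    have "(\<Sum>q\<in>Q. w q * g q) = (\<Sum>u\<in>P \<union> F. \<Sum>v\<in>P. w (u, v) * g (u, v))"
      unfolding Q_def by (simp add: sum.cartesian_product)
    also have "\<dots> = (\<Sum>u\<in>P \<union> F. b * ((if u \<in> P then \<Sum>k<n. Y (Suc k) * (\<mu> u * (\<rho> k u * avg k (\<lambda>v. g (u, v)) u)) else 0)
        + (if u \<in> F then e * avg n (\<lambda>v. g (u, v)) u else 0)))"
    proof (rule sum.cong[OF refl])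
      fix u
      have "(\<Sum>v\<in>P. (\<Sum>k<n. Y (Suc k) * (\<mu> u * (\<rho> k u * \<kappa> k u v))) * g (u, v)) =
         (\<Sum>k<n. Y (Suc k) * (\<mu> u * (\<rho> k u * avg k (\<lambda>v. g (u, v)) u)))"
        unfolding sum_distrib_right avg_def sum_distrib_left
        by (subst sum.swap) (simp add: mult_ac)
      moreover have "(\<Sum>v\<in>P. e * \<kappa> n u v * g (u, v)) = e * avg n (\<lambda>v. g (u, v)) u"
        by (simp add: avg_def sum_distrib_left mult.assoc)
      ultimately show "(\<Sum>v\<in>P. w (u, v) * g (u, v)) = b * ((if u \<in> P then \<Sum>k<n. Y (Suc k) * (\<mu> u * (\<rho> k u * avg k (\<lambda>v. g (u, v)) u)) else 0)
        + (if u \<in> F then e * avg n (\<lambda>v. g (u, v)) u else 0))"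
        unfolding w_def
        by (auto simp: mult.assoc distrib_right distrib_left sum.distrib sum_distrib_left[symmetric])
    qed
    also have "\<dots> = b * ((\<Sum>u\<in>P \<union> F. if u \<in> P then \<Sum>k<n. Y (Suc k) * (\<mu> u * (\<rho> k u * avg k (\<lambda>v. g (u, v)) u)) else 0)
        + (\<Sum>u\<in>P \<union> F. if u \<in> F then e * avg n (\<lambda>v. g (u, v)) u else 0))"
      by (simp add: sum.distrib sum_distrib_left[symmetric])
    also have "(\<Sum>u\<in>P \<union> F. if u \<in> P then \<Sum>k<n. Y (Suc k) * (\<mu> u * (\<rho> k u * avg k (\<lambda>v. g (u, v)) u)) else 0)
        = (\<Sum>u\<in>P. \<Sum>k<n. Y (Suc k) * (\<mu> u * (\<rho> k u * avg k (\<lambda>v. g (u, v)) u)))"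
      using fin F by (intro sum.mono_neutral_cong_right) auto
    also have "\<dots> = (\<Sum>k<n. Y (Suc k) * mean (\<lambda>u. \<rho> k u * avg k (\<lambda>v. g (u, v)) u))"
      unfolding mean_def sum_distrib_left by (rule sum.swap)
    also have "(\<Sum>u\<in>P \<union> F. if u \<in> F then e * avg n (\<lambda>v. g (u, v)) u else 0)
        = (\<Sum>u\<in>F. e * avg n (\<lambda>v. g (u, v)) u)"
      using fin F by (intro sum.mono_neutral_cong_right) auto
    finally show ?thesis .
  qed
  \<comment> \<open>\<open>\<mu>\<close> has total mass 1, being the kernel at scale 0.\<close>
  have mean_const: "mean (\<lambda>u. c) = c" for c
    using avg_0 avg_const by metis
  have "sum w Q = b * ((\<Sum>k<n. Y (Suc k) * mean (\<rho> k)) + card F * e)"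
    using sum_w[of "\<lambda>_. 1"] by (simp add: avg_const)
  also have "(\<Sum>k<n. Y (Suc k) * mean (\<rho> k)) = mean (\<lambda>u. \<Sum>k<n. Y (Suc k) * \<rho> k u)"
    unfolding mean_def sum_distrib_left by (subst sum.swap) (simp add: mult_ac)
  also have "\<dots> \<le> mean (\<lambda>u. C)"
    unfolding mean_def
  proof (intro sum_mono mult_left_mono mu_nonneg)
    fix u
    have "(\<Sum>k<n. Y (Suc k) * \<rho> k u) \<le> (\<Sum>k\<le>n. Y (Suc k) * \<rho> k u)"
      using Y0 rho_nonneg by (intro sum_mono2) auto
    then show "(\<Sum>k<n. Y (Suc k) * \<rho> k u) \<le> C" using C[of u] by linarith
  qed
  finally have mass: "sum w Q \<le> b * (C + card F * e)"
    using ab by (simp add: mean_const mult_left_mono)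
  have single: "\<bar>f s - mean f\<bar> \<le> a * ((R - 1) / (R - 2) * C + e) + (\<Sum>q\<in>Q. w q * increment \<phi> f q)"
    if s: "s \<in> F" for f s
  proof -
    let ?I = "\<lambda>u. avg n (\<lambda>v. increment \<phi> f (u, v)) u"
    have I0: "0 \<le> ?I u" for u by (intro avg_nonneg increment_nonneg)
    have "\<bar>f s - avg n f s\<bar> \<le> (Y (Suc n) * \<rho> n s) * (a + b / \<phi> (Y (Suc n)) * ?I s)"
      using abs_diff_avg_le[of f s n "Suc n"] by (simp add: mult_ac)
    \<comment> \<open>No averaging follows this link, so the denominator is simply bounded below by
      1.\<close>
    also have "\<dots> \<le> e * (a + b * ?I s)"
    proof (intro mult_mono[OF bspec[OF e(1) s]] add_left_mono mult_right_mono I0 e(2))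
      show "b / \<phi> (Y (Suc n)) \<le> b"
        using phi_Y[of "Suc n"] ab by (simp add: divide_le_eq mult_left_le_one_le mult_le_cancel_left1)
      show "0 \<le> a + b / \<phi> (Y (Suc n)) * ?I s"
        using ab phi_Y[of "Suc n"] I0[of s]
        by (intro add_nonneg_nonneg mult_nonneg_nonneg divide_nonneg_nonneg) auto
    qed
    also have "\<dots> \<le> a * e + b * (\<Sum>u\<in>F. e * ?I u)"
    proof -
      have "e * ?I s \<le> (\<Sum>u\<in>F. e * ?I u)"
        using s F e(2) I0 by (intro member_le_sum) auto
      then have "b * (e * ?I s) \<le> b * (\<Sum>u\<in>F. e * ?I u)" using ab by (intro mult_left_mono)
      then show ?thesis by (simp add: algebra_simps)
    qed
    finally have 1: "\<bar>f s - avg n f s\<bar> \<le> a * e + b * (\<Sum>u\<in>F. e * ?I u)" .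
    have 2: "a * (\<Sum>j<n. (top_coeff Y j + Y (Suc j)) * \<rho> j s) + a * top_coeff Y n * \<rho> n s
        \<le> a * ((R - 1) / (R - 2) * C)"
    proof (cases "a = 0")
      case False
      then have R2: "R > 2" using R by simp
      have t: "top_coeff Y j \<le> Y (Suc j) / (R - 2)" for j
        using R2 Y0 YR by (intro top_coeff_le)
      \<comment> \<open>Adding \<open>Y (Suc n)\<close> to the last coefficient completes the sum to
        all \<open>j \<le> n\<close>.\<close>
      have "(\<Sum>j<n. (top_coeff Y j + Y (Suc j)) * \<rho> j s) + top_coeff Y n * \<rho> n s
          \<le> (\<Sum>j\<le>n. (top_coeff Y j + Y (Suc j)) * \<rho> j s)"
        using Y0[of "Suc n"] rho_nonneg[of n s]
        by (simp add: lessThan_Suc_atMost[symmetric] distrib_right)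
      also have "\<dots> \<le> (\<Sum>j\<le>n. (R - 1) / (R - 2) * (Y (Suc j) * \<rho> j s))"
      proof (rule sum_mono)
        fix j
        have "(top_coeff Y j + Y (Suc j)) * \<rho> j s \<le> (Y (Suc j) / (R - 2) + Y (Suc j)) * \<rho> j s"
          using t rho_nonneg by (intro mult_right_mono) auto
        also have "\<dots> = (R - 1) / (R - 2) * (Y (Suc j) * \<rho> j s)"
          using R2 by (simp add: field_simps)
        finally show "(top_coeff Y j + Y (Suc j)) * \<rho> j s \<le> (R - 1) / (R - 2) * (Y (Suc j) * \<rho> j s)" .
      qed
      also have "\<dots> \<le> (R - 1) / (R - 2) * C"
        unfolding sum_distrib_left[symmetric] using R2 by (intro mult_left_mono C) auto
      finally show ?thesis
        using mult_left_mono ab(1) by (fastforce simp: distrib_left mult.assoc)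
    qed simp
    have "\<bar>f s - mean f\<bar> \<le> \<bar>f s - avg n f s\<bar> + \<bar>avg n f s - mean f\<bar>" by simp
    also have "\<dots> \<le> a * e + b * (\<Sum>u\<in>F. e * ?I u)
        + (a * ((R - 1) / (R - 2) * C) + b * (\<Sum>k<n. Y (Suc k) * energy k f))"
      using 1 2 avg_deviation[of n f s] by linarith
    also have "\<dots> = a * ((R - 1) / (R - 2) * C + e) + (\<Sum>q\<in>Q. w q * increment \<phi> f q)"
      unfolding sum_w energy_def by (simp add: distrib_left)
    finally show ?thesis .
  qed
  have "\<bar>f s - f t\<bar> / 2 \<le> a * ((R - 1) / (R - 2) * C + e) + (\<Sum>q\<in>Q. w q * increment \<phi> f q)"
    if "s \<in> F" "t \<in> F" for f s t
  proof -
    have "\<bar>x - y\<bar> / 2 \<le> c" if "\<bar>x - z\<bar> \<le> c" "\<bar>y - z\<bar> \<le> c" for x y z c :: real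
      using that by (auto simp: abs_le_iff)
    then show ?thesis using single[OF that(1)] single[OF that(2)] .
  qed
  moreover have "finite Q" using fin F by (simp add: Q_def)
  ultimately show ?thesis using w0 mass by blast
qed

end

subsection \<open>Majorizing measures\<close>

text \<open>Each new ball keeps only what the earlier cells have left over. Applied to a finite net,
  this partitions the space into small cells.\<close>

lemma finite_disjoint_cells:
  fixes P :: "'a::metric_space set"
  assumes "finite P"
  shows "\<exists>A. (\<forall>p\<in>P. A p \<in> sets borel \<and> A p \<subseteq> cball p \<delta>) \<and> disjoint_family_on A P \<and>
     (\<Union>p\<in>P. A p) = (\<Union>p\<in>P. cball p \<delta>)"
  using assms
proof (induction P)
  case empty
  then show ?case by (auto simp: disjoint_family_on_def)
next
  case (insert x P)
  then obtain A where A: "\<forall>p\<in>P. A p \<in> sets borel \<and> A p \<subseteq> cball p \<delta>" "disjoint_family_on A P"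
     "(\<Union>p\<in>P. A p) = (\<Union>p\<in>P. cball p \<delta>)" by blast
  define A' where "A' = A(x := cball x \<delta> - (\<Union>p\<in>P. A p))"
  have "(\<Union>p\<in>P. A p) \<in> sets borel" using A(1) insert(1) by auto
  then have "\<forall>p\<in>insert x P. A' p \<in> sets borel \<and> A' p \<subseteq> cball p \<delta>"
    using A(1) insert(2) by (auto simp: A'_def)
  moreover have "disjoint_family_on A' (insert x P)"
    using A(2) insert(2) by (auto simp: A'_def disjoint_family_on_def)
  moreover have "(\<Union>p\<in>P. A' p) = (\<Union>p\<in>P. A p)"
    using insert(2) by (intro SUP_cong) (auto simp: A'_def)
  then have "(\<Union>p\<in>insert x P. A' p) = (\<Union>p\<in>insert x P. cball p \<delta>)"
    using A(3) by (auto simp: A'_def)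
  ultimately show ?case by blast
qed

text \<open>The integral is given as a finite real \<open>S\<close>; an infinite integral forces
  \<open>K\<close> to be 0 or infinite, which the theorem settles separately.\<close>

locale majorizing_measure = prob_space m for m :: "'a::metric_space measure" +
  fixes \<phi> :: "real \<Rightarrow> real" and a b R S :: real
  assumes sets_m: "sets m = sets borel" and support: "measure_support m = UNIV"
    and ab: "0 \<le> a" "0 \<le> b" and phi: "\<phi> \<in> growth_class a b" and R: "2 \<le> R"
    and S: "majorizing_integral \<phi> m = ennreal S" "0 \<le> S"
begin

section \<open>The inverse of \<open>\<phi>\<close>, the scales \<open>Y k\<close> and boundedness
  of the space\<close>

lemma space_m: "space m = UNIV"
  using sets_eq_imp_space_eq[OF sets_m] by simp

lemma cball_sets [measurable, simp]: "cball x r \<in> sets m"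
  by (simp add: sets_m)

lemma phi_0: "\<phi> 0 = 0"
  using phi by (simp add: growth_class_def)

lemma phi_less: "0 \<le> x \<Longrightarrow> x < y \<Longrightarrow> \<phi> x < \<phi> y"
  using phi by (auto simp: growth_class_def strict_mono_on_def)

lemma phi_le: "0 \<le> x \<Longrightarrow> x \<le> y \<Longrightarrow> \<phi> x \<le> \<phi> y"
  using phi_less by (cases "x = y") (auto simp: less_le)

lemma phi_nonneg: "0 \<le> x \<Longrightarrow> 0 \<le> \<phi> x"
  using phi_le[of 0 x] phi_0 by simp

lemma phi_pos: "0 < x \<Longrightarrow> 0 < \<phi> x"
  using phi_less[of 0 x] phi_0 by simp

lemma phi_inv:
  assumes "0 \<le> t"
  shows "0 \<le> inv_Rplus \<phi> t" "\<phi> (inv_Rplus \<phi> t) = t"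
proof -
  have inj: "inj_on \<phi> {0..}" and im: "\<phi> ` {0..} = {0..}"
    using phi by (auto simp: growth_class_def intro: strict_mono_on_imp_inj_on)
  have "t \<in> \<phi> ` {0..}" using im assms by simp
  then show "0 \<le> inv_Rplus \<phi> t" "\<phi> (inv_Rplus \<phi> t) = t"
    using the_inv_into_into[OF inj _ order_refl, of t] f_the_inv_into_f[OF inj, of t]
    by (auto simp: inv_Rplus_def)
qed

lemma le_inv:
  assumes "0 \<le> y" "\<phi> y \<le> t"
  shows "y \<le> inv_Rplus \<phi> t"
proof (rule ccontr)
  have t: "0 \<le> t" using assms phi_nonneg[of y] by simp
  assume "\<not> ?thesis"
  then have "t < \<phi> y" using phi_less[of "inv_Rplus \<phi> t" y] phi_inv[OF t] by simp
  then show False using assms by simp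
qed

definition c :: real where "c = inv_Rplus \<phi> 1"

definition Y :: "nat \<Rightarrow> real" where "Y k = c * R ^ k"

lemma c_pos: "0 < c"
proof -
  have "c \<noteq> 0" using phi_inv(2)[of 1] phi_0 by (auto simp: c_def)
  then show ?thesis using phi_inv(1)[of 1] by (simp add: c_def)
qed

lemma Y_pos: "0 < Y k"
  using c_pos R by (simp add: Y_def)

lemma Y_Suc: "Y (Suc k) = R * Y k"
  by (simp add: Y_def)

lemma Y_ge: "c \<le> Y k"
  using c_pos R by (simp add: Y_def)

lemma phi_Y_0: "\<phi> (Y 0) = 1"
  using phi_inv(2)[of 1] by (simp add: Y_def c_def)

lemma phi_Y: "1 \<le> \<phi> (Y k)"
  using phi_le[OF less_imp_le[OF c_pos] Y_ge[of k]] phi_inv(2)[of 1] by (simp add: c_def)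

lemma growth: "0 \<le> x \<Longrightarrow> x \<le> a + b * (\<phi> (x * Y k) / \<phi> (Y k))"
  using phi Y_ge[of k] by (simp add: growth_class_def c_def)

lemma prob_cball_pos:
  assumes "0 < \<epsilon>"
  shows "0 < prob (cball x \<epsilon>)"
proof -
  have "x \<in> measure_support m" using support by simp
  moreover have "open (ball x \<epsilon>)" "x \<in> ball x \<epsilon>" using assms by auto
  ultimately have "0 < emeasure m (ball x \<epsilon>)" unfolding measure_support_def by blast
  also have "\<dots> \<le> emeasure m (cball x \<epsilon>)"
    by (intro emeasure_mono ball_subset_cball cball_sets)
  finally show ?thesis by (simp add: emeasure_eq_measure)
qed

lemma integral_le:
  "(\<integral>\<^sup>+\<epsilon>\<in>{\<epsilon>. 0 < \<epsilon> \<and> ennreal \<epsilon> < ediameter (UNIV :: 'a set)}.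
        ennreal (inv_Rplus \<phi> (1 / prob (cball x \<epsilon>))) \<partial>lborel) \<le> ennreal S"
  unfolding S(1)[symmetric] majorizing_integral_def by (rule SUP_upper) simp

lemma less_ediameter:
  fixes s t :: 'a
  assumes "\<epsilon> < dist s t" "0 \<le> \<epsilon>"
  shows "ennreal \<epsilon> < ediameter (UNIV :: 'a set)"
proof -
  have "ennreal \<epsilon> < ennreal (dist s t)" using assms by (simp add: ennreal_less_iff)
  also have "\<dots> \<le> (SUP t. ennreal (dist s t))" by (rule SUP_upper) simp
  also have "\<dots> \<le> ediameter (UNIV :: 'a set)" unfolding ediameter_def by (rule SUP_upper) simp
  finally show ?thesis .
qed

text \<open>Balls have mass at most 1, so the integrand is at least \<open>c\<close> on the interval
  from 0 to \<open>dist s t\<close>; a finite integral therefore bounds all distances.\<close>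

lemma dist_bounded: "dist (s::'a) t \<le> S / c"
proof -
  have "ennreal (c * dist s t) = (\<integral>\<^sup>+\<epsilon>. ennreal c * indicator {0<..<dist s t} \<epsilon> \<partial>lborel)"
    using c_pos by (simp add: nn_integral_cmult_indicator ennreal_mult)
  also have "\<dots> \<le> (\<integral>\<^sup>+\<epsilon>\<in>{\<epsilon>. 0 < \<epsilon> \<and> ennreal \<epsilon> < ediameter (UNIV :: 'a set)}.
        ennreal (inv_Rplus \<phi> (1 / prob (cball s \<epsilon>))) \<partial>lborel)"
  proof (rule nn_integral_mono)
    fix \<epsilon> :: real
    have "c \<le> inv_Rplus \<phi> (1 / prob (cball s \<epsilon>))" if "0 < \<epsilon>"
      using c_pos phi_Y_0 prob_cball_pos[OF that, of s]
      by (intro le_inv) (auto simp: Y_def)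
    then show "ennreal c * indicator {0<..<dist s t} \<epsilon>
       \<le> ennreal (inv_Rplus \<phi> (1 / prob (cball s \<epsilon>))) *
         indicator {\<epsilon>. 0 < \<epsilon> \<and> ennreal \<epsilon> < ediameter (UNIV :: 'a set)} \<epsilon>"
      using less_ediameter[of \<epsilon> s t] by (auto simp: indicator_def intro!: ennreal_leI)
  qed
  also have "\<dots> \<le> ennreal S" by (rule integral_le)
  finally show ?thesis using S(2) c_pos by (simp add: field_simps)
qed

section \<open>Radii of balls of prescribed mass\<close>

definition r :: "nat \<Rightarrow> 'a \<Rightarrow> real" where
  "r k x = Inf {\<epsilon>. 0 \<le> \<epsilon> \<and> 1 / \<phi> (Y k) \<le> prob (cball x \<epsilon>)}"

lemma radii_nonempty: "S / c \<in> {\<epsilon>. 0 \<le> \<epsilon> \<and> 1 / \<phi> (Y k) \<le> prob (cball x \<epsilon>)}"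
proof -
  have "cball x (S / c) = space m"
    using dist_bounded by (auto simp: space_m)
  then show ?thesis using S(2) c_pos phi_Y[of k] by (simp add: prob_space)
qed

lemma radii_bdd_below: "bdd_below {\<epsilon>. 0 \<le> \<epsilon> \<and> 1 / \<phi> (Y k) \<le> prob (cball x \<epsilon>)}"
  by (intro bdd_belowI[of _ 0]) auto

lemma r_nonneg: "0 \<le> r k x"
  unfolding r_def
proof (rule cInf_greatest)
  show "{\<epsilon>. 0 \<le> \<epsilon> \<and> 1 / \<phi> (Y k) \<le> prob (cball x \<epsilon>)} \<noteq> {}"
    using radii_nonempty by blast
qed simp

text \<open>A ball around \<open>y\<close> lies in the ball around \<open>x\<close> whose radius is
  larger by \<open>dist x y\<close>.\<close>

lemma r_lipschitz: "r k x \<le> r k y + dist x y"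
proof -
  have "r k x - dist x y \<le> r k y"
    unfolding r_def[of k y]
  proof (rule cInf_greatest)
    show "{\<epsilon>. 0 \<le> \<epsilon> \<and> 1 / \<phi> (Y k) \<le> prob (cball y \<epsilon>)} \<noteq> {}"
      using radii_nonempty by blast
    fix \<epsilon> assume e: "\<epsilon> \<in> {\<epsilon>. 0 \<le> \<epsilon> \<and> 1 / \<phi> (Y k) \<le> prob (cball y \<epsilon>)}"
    have "cball y \<epsilon> \<subseteq> cball x (\<epsilon> + dist x y)"
    proof
      fix z assume "z \<in> cball y \<epsilon>"
      then show "z \<in> cball x (\<epsilon> + dist x y)"
        using dist_triangle[of x z y] by simp
    qed
    then have "prob (cball y \<epsilon>) \<le> prob (cball x (\<epsilon> + dist x y))"
      by (intro finite_measure_mono) auto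
    then have "r k x \<le> \<epsilon> + dist x y"
      unfolding r_def using e by (intro cInf_lower radii_bdd_below) auto
    then show "r k x - dist x y \<le> \<epsilon>" by simp
  qed
  then show ?thesis by simp
qed

text \<open>Stated strictly above the infimum, so that its attainment need not be discussed; the
  balls used later have radius \<open>r k x + \<delta>\<close>.\<close>

lemma prob_above_r:
  assumes "r k x < \<epsilon>"
  shows "1 / \<phi> (Y k) \<le> prob (cball x \<epsilon>)"
proof -
  obtain \<epsilon>' where e: "\<epsilon>' < \<epsilon>" "1 / \<phi> (Y k) \<le> prob (cball x \<epsilon>')"
    using cInf_lessD[of "{\<epsilon>. 0 \<le> \<epsilon> \<and> 1 / \<phi> (Y k) \<le> prob (cball x \<epsilon>)}" \<epsilon>]
      radii_nonempty[of k x] assms unfolding r_def by blast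
  have "prob (cball x \<epsilon>') \<le> prob (cball x \<epsilon>)"
    using e(1) by (intro finite_measure_mono) auto
  then show ?thesis using e(2) by simp
qed

lemma prob_below_r:
  assumes "0 \<le> \<epsilon>" "\<epsilon> < r k x"
  shows "prob (cball x \<epsilon>) < 1 / \<phi> (Y k)"
proof (rule ccontr)
  assume "\<not> ?thesis"
  then have "r k x \<le> \<epsilon>"
    unfolding r_def using assms(1) by (intro cInf_lower radii_bdd_below) auto
  then show False using assms(2) by simp
qed

text \<open>For \<open>k > 0\<close> the term is \<open>Y k - Y (k - 1)\<close>, so the sum
  telescopes.\<close>

lemma sum_Y_le: "(\<Sum>k\<le>n. (1 - 1 / R) * Y k) \<le> Y n"
proof (induction n)
  case 0
  then show ?case using R Y_pos[of 0] by (simp add: mult_le_cancel_right2)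
next
  case (Suc n)
  then have "(\<Sum>k\<le>Suc n. (1 - 1 / R) * Y k) \<le> Y n + (1 - 1 / R) * Y (Suc n)" by simp
  also have "\<dots> = Y (Suc n)" using R by (simp add: Y_Suc field_simps)
  finally show ?case .
qed

text \<open>Each radius is the length of an interval, so the sum is an integral over
  \<open>\<epsilon>\<close>. At a given \<open>\<epsilon>\<close> only scales with
  \<open>\<epsilon> < r k x\<close> contribute; if \<open>j\<close> is the largest, their weights
  add up to at most \<open>Y j\<close>, while the mass of the ball is below
  \<open>1 / \<phi> (Y j)\<close>, which makes the integrand at least \<open>Y j\<close>.\<close>

lemma sum_r_le: "(\<Sum>k\<le>n. (1 - 1 / R) * Y k * r k x) \<le> S"
proof -
  have R1: "0 \<le> 1 - 1 / R" using R by simp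
  have cf: "0 \<le> (1 - 1 / R) * Y k" for k using R1 Y_pos[of k] by simp
  have "ennreal (\<Sum>k\<le>n. (1 - 1 / R) * Y k * r k x) =
      (\<Sum>k\<le>n. ennreal ((1 - 1 / R) * Y k) * emeasure lborel {0<..<r k x})"
    using cf r_nonneg by (simp add: sum_ennreal[symmetric] ennreal_mult)
  also have "\<dots> = (\<integral>\<^sup>+\<epsilon>. (\<Sum>k\<le>n. ennreal ((1 - 1 / R) * Y k) * indicator {0<..<r k x} \<epsilon>) \<partial>lborel)"
    by (subst nn_integral_sum) (auto simp: nn_integral_cmult_indicator)
  also have "\<dots> \<le> (\<integral>\<^sup>+\<epsilon>\<in>{\<epsilon>. 0 < \<epsilon> \<and> ennreal \<epsilon> < ediameter (UNIV :: 'a set)}.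
        ennreal (inv_Rplus \<phi> (1 / prob (cball x \<epsilon>))) \<partial>lborel)"
  proof (rule nn_integral_mono)
    fix \<epsilon> :: real
    let ?J = "{k. k \<le> n \<and> 0 < \<epsilon> \<and> \<epsilon> < r k x}"
    have "(\<Sum>k\<le>n. ennreal ((1 - 1 / R) * Y k) * indicator {0<..<r k x} \<epsilon>) =
        (\<Sum>k\<in>?J. ennreal ((1 - 1 / R) * Y k))"
      by (intro sum.mono_neutral_cong_right) (auto simp: indicator_def)
    also have "\<dots> \<le> ennreal (inv_Rplus \<phi> (1 / prob (cball x \<epsilon>))) *
         indicator {\<epsilon>. 0 < \<epsilon> \<and> ennreal \<epsilon> < ediameter (UNIV :: 'a set)} \<epsilon>"
    proof (cases "?J = {}")
      case True
      then show ?thesis unfolding True by simp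
    next
      case False
      define j where "j = Max ?J"
      have finJ: "finite ?J" by simp
      have jJ: "j \<in> ?J" unfolding j_def using finJ False by (rule Max_in)
      then have e: "0 < \<epsilon>" "\<epsilon> < r j x" by auto
      have small: "prob (cball x \<epsilon>) < 1 / \<phi> (Y j)" using e by (intro prob_below_r) auto
      have "prob (cball x \<epsilon>) \<noteq> 1" using small phi_Y[of j] by (auto simp: field_simps)
      \<comment> \<open>A point outside the ball shows that \<open>\<epsilon>\<close> is below the
        diameter, hence in the range of integration.\<close>
      then have "cball x \<epsilon> \<noteq> UNIV" using prob_space space_m by auto
      then obtain z where z: "\<epsilon> < dist x z" by (metis UNIV_eq_I mem_cball not_le)
      have "(\<Sum>k\<in>?J. (1 - 1 / R) * Y k) \<le> (\<Sum>k\<le>j. (1 - 1 / R) * Y k)"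
        using finJ cf by (intro sum_mono2) (auto simp: j_def intro!: Max_ge)
      also have "\<dots> \<le> Y j" by (rule sum_Y_le)
      also have "Y j \<le> inv_Rplus \<phi> (1 / prob (cball x \<epsilon>))"
        using small prob_cball_pos[OF e(1), of x] phi_Y[of j] Y_pos[of j]
        by (intro le_inv) (auto simp: field_simps)
      finally show ?thesis
        using e(1) less_ediameter[OF z] cf by (simp add: sum_ennreal ennreal_leI)
    qed
    finally show "(\<Sum>k\<le>n. ennreal ((1 - 1 / R) * Y k) * indicator {0<..<r k x} \<epsilon>) \<le>
        ennreal (inv_Rplus \<phi> (1 / prob (cball x \<epsilon>))) *
         indicator {\<epsilon>. 0 < \<epsilon> \<and> ennreal \<epsilon> < ediameter (UNIV :: 'a set)} \<epsilon>" .
  qed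
  also have "\<dots> \<le> ennreal S" by (rule integral_le)
  finally show ?thesis using S(2) by simp
qed

text \<open>The shift from \<open>Y k\<close> to \<open>Y (Suc k)\<close> costs \<open>R\<close>,
  and dividing by \<open>1 - 1 / R\<close> turns it into \<open>R^2 / (R - 1)\<close>.\<close>

lemma sum_Y_r_le: "(\<Sum>k\<le>n. Y (Suc k) * r k x) \<le> R ^ 2 / (R - 1) * S"
proof -
  have "(\<Sum>k\<le>n. Y (Suc k) * r k x) = (\<Sum>k\<le>n. R ^ 2 / (R - 1) * ((1 - 1 / R) * Y k * r k x))"
    using R by (intro sum.cong) (auto simp: Y_Suc field_simps power2_eq_square)
  also have "\<dots> \<le> R ^ 2 / (R - 1) * S"
    unfolding sum_distrib_left[symmetric] using R by (intro mult_left_mono sum_r_le) auto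
  finally show ?thesis .
qed

lemma Y_r_tendsto_0: "(\<lambda>k. Y (Suc k) * r k x) \<longlonglongrightarrow> 0"
proof (intro summable_LIMSEQ_zero summableI_nonneg_bounded)
  fix n
  show nn: "0 \<le> Y (Suc n) * r n x" for n using Y_pos[of "Suc n"] r_nonneg[of n x] by simp
  have "(\<Sum>k<n. Y (Suc k) * r k x) \<le> (\<Sum>k\<le>n. Y (Suc k) * r k x)"
    using nn by (intro sum_mono2) auto
  also have "\<dots> \<le> R ^ 2 / (R - 1) * S" by (rule sum_Y_r_le)
  finally show "(\<Sum>k<n. Y (Suc k) * r k x) \<le> R ^ 2 / (R - 1) * S" .
qed

section \<open>Uniform mass of balls and total boundedness\<close>

lemma prob_cball_bounded_below:
  assumes "0 < \<delta>"
  shows "\<exists>\<theta>>0. \<forall>x. \<theta> \<le> prob (cball x \<delta>)"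
proof -
  \<comment> \<open>The bound on \<open>Y (Suc k) * r k x\<close> is uniform in \<open>x\<close>, so
    one large \<open>k\<close> brings all radii at that scale below \<open>\<delta>\<close>.\<close>
  obtain k where k: "R ^ 2 / (R - 1) * S / (c * \<delta>) < R ^ k"
    using real_arch_pow[of R] R by auto
  have "r k x < \<delta>" for x
  proof -
    have "Y (Suc k) * r k x \<le> (\<Sum>k\<le>k. Y (Suc k) * r k x)"
      using Y_pos r_nonneg by (intro member_le_sum) (auto intro!: mult_nonneg_nonneg simp: less_imp_le)
    also have "\<dots> \<le> R ^ 2 / (R - 1) * S" by (rule sum_Y_r_le)
    also have "\<dots> < R ^ k * (c * \<delta>)"
      using k c_pos assms by (subst (asm) pos_divide_less_eq) auto
    also have "\<dots> = Y k * \<delta>" by (simp add: Y_def)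
    also have "\<dots> \<le> Y (Suc k) * \<delta>"
      using R Y_pos[of k] assms by (auto simp: Y_Suc)
    finally show ?thesis using Y_pos[of "Suc k"] by simp
  qed
  then have "\<forall>x. 1 / \<phi> (Y k) \<le> prob (cball x \<delta>)" using prob_above_r by blast
  moreover have "0 < 1 / \<phi> (Y k)" using phi_Y[of k] by simp
  ultimately show ?thesis by blast
qed

text \<open>Half-radius balls around \<open>\<delta>\<close>-separated points are disjoint and each
  has mass at least \<open>\<theta>\<close>, so there are at most \<open>1 / \<theta>\<close> of
  them. A separated set of maximal cardinality is a net.\<close>

lemma finite_net:
  assumes "0 < \<delta>"
  shows "\<exists>P::'a set. finite P \<and> (\<Union>p\<in>P. cball p \<delta>) = UNIV"
proof -
  obtain \<theta> where th: "0 < \<theta>" "\<And>x. \<theta> \<le> prob (cball x (\<delta> / 2))"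
    using prob_cball_bounded_below[of "\<delta> / 2"] assms by auto
  define sep where "sep P \<longleftrightarrow> finite P \<and> (\<forall>p\<in>P. \<forall>q\<in>P. p \<noteq> q \<longrightarrow> \<delta> < dist p q)" for P :: "'a set"
  have bound: "card P \<le> nat \<lfloor>1 / \<theta>\<rfloor>" if "sep P" for P
  proof -
    have "disjoint_family_on (\<lambda>p. cball p (\<delta> / 2)) P"
      unfolding disjoint_family_on_def
    proof (intro ballI impI)
      fix p q assume "p \<in> P" "q \<in> P" "p \<noteq> q"
      then have d: "\<delta> < dist p q" using that by (simp add: sep_def)
      show "cball p (\<delta> / 2) \<inter> cball q (\<delta> / 2) = {}"
      proof (rule ccontr)
        assume "\<not> ?thesis"
        then obtain z where "dist p z \<le> \<delta> / 2" "dist q z \<le> \<delta> / 2" by auto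
        then show False using d dist_triangle2[of p q z] by simp
      qed
    qed
    then have "prob (\<Union>p\<in>P. cball p (\<delta> / 2)) = (\<Sum>p\<in>P. prob (cball p (\<delta> / 2)))"
      using that by (intro finite_measure_finite_Union) (auto simp: sep_def)
    moreover have "(\<Sum>p\<in>P. \<theta>) \<le> (\<Sum>p\<in>P. prob (cball p (\<delta> / 2)))"
      using th(2) by (intro sum_mono)
    ultimately have "card P * \<theta> \<le> 1" using prob_le_1 by (metis order_trans sum_constant)
    then show ?thesis using th(1) by (intro le_nat_floor) (simp add: field_simps)
  qed
  have "sep {}" by (simp add: sep_def)
  then have "\<exists>P. sep P \<and> (\<forall>P'. sep P' \<longrightarrow> card P' \<le> card P)"
    using bound by (intro ex_has_greatest_nat[where b = "Suc (nat \<lfloor>1 / \<theta>\<rfloor>)"]) (auto simp: less_Suc_eq_le)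
  then obtain P where P: "sep P" "\<And>P'. sep P' \<Longrightarrow> card P' \<le> card P" by auto
  have "\<exists>p\<in>P. dist p x \<le> \<delta>" for x
  proof (rule ccontr)
    assume far: "\<not> ?thesis"
    then have "x \<notin> P" using assms by fastforce
    moreover have "sep (insert x P)"
      using P(1) far by (auto simp: sep_def dist_commute not_le)
    ultimately show False using P(2)[of "insert x P"] P(1) by (simp add: sep_def)
  qed
  then show ?thesis using P(1) by (auto simp: sep_def)
qed

text \<open>The finite model is instantiated with \<open>m\<close> conditioned on balls and pushed
  to the cells of a fine partition. The slack \<open>\<eta>\<close> pays for this discretization and
  for stopping the chain at a finite scale.\<close>

lemma majorizing_pair_bound:
  fixes F :: "'a set"
  assumes aR: "a = 0 \<or> R > 2" and F: "finite F" and eta: "0 < \<eta>"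
  shows "\<exists>Q w. finite Q \<and> (\<forall>q. 0 \<le> w q) \<and> sum w Q \<le> b * (R ^ 2 / (R - 1)) * S + \<eta> \<and>
    (\<forall>f. \<forall>s\<in>F. \<forall>t\<in>F. \<bar>f s - f t\<bar> / 2 \<le>
       a * (R ^ 3 / ((R - 1) * (R - 2))) * S + \<eta> + (\<Sum>q\<in>Q. w q * increment \<phi> f q))"
proof -
  \<comment> \<open>\<open>D\<close> dominates the coefficients of \<open>e\<close> in both error
    terms, so that \<open>e = \<eta> / D\<close> keeps each of them below \<open>\<eta>\<close>; the
    summand 1 makes it positive.\<close>
  define D where "D = 1 + b * (1 + card F) + a * ((R - 1) / (R - 2) + 1)"
  define e where "e = \<eta> / D"
  have p0: "0 \<le> b * (1 + card F)" "0 \<le> a * ((R - 1) / (R - 2) + 1)"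
    using ab R by (auto intro!: mult_nonneg_nonneg add_nonneg_nonneg divide_nonneg_nonneg)
  then have D: "0 < D" by (simp add: D_def)
  have e0: "0 < e" using eta D by (simp add: e_def)
  have De: "D * e = \<eta>" using D by (simp add: e_def)
  have e1: "b * (1 + card F) * e \<le> \<eta>" "a * ((R - 1) / (R - 2) + 1) * e \<le> \<eta>"
    unfolding De[symmetric] using e0 p0 by (auto intro!: mult_right_mono simp: D_def)
  have "\<forall>\<^sub>F n in sequentially. \<forall>x\<in>F. Y (Suc n) * r n x < e / 2"
    using F e0 by (intro eventually_ball_finite ballI order_tendstoD(2)[OF Y_r_tendsto_0]) auto
  then obtain n where n: "\<And>x. x \<in> F \<Longrightarrow> Y (Suc n) * r n x < e / 2"
    by (auto simp: eventually_sequentially)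
  \<comment> \<open>Enlarging every radius up to scale \<open>n\<close> by
    \<open>2 * \<delta>\<close> costs \<open>Z * (2 * \<delta>)\<close>; \<open>\<delta>\<close> is
    chosen to make this \<open>e / 2\<close>.\<close>
  define Z where "Z = (\<Sum>k\<le>n. Y (Suc k))"
  have YZ: "Y (Suc n) \<le> Z"
    unfolding Z_def using Y_pos by (intro member_le_sum) (auto intro: less_imp_le)
  then have Z: "0 < Z" using Y_pos[of "Suc n"] by linarith
  define \<delta> where "\<delta> = e / (4 * Z)"
  have d0: "0 < \<delta>" and dZ: "Z * (2 * \<delta>) = e / 2" using e0 Z by (auto simp: \<delta>_def)
  obtain P :: "'a set" where P: "finite P" "(\<Union>p\<in>P. cball p \<delta>) = UNIV"
    using finite_net[OF d0] by blast
  obtain A where A: "\<And>p. p \<in> P \<Longrightarrow> A p \<in> sets m" "\<And>p. p \<in> P \<Longrightarrow> A p \<subseteq> cball p \<delta>"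
     "disjoint_family_on A P" "(\<Union>p\<in>P. A p) = UNIV"
    using finite_disjoint_cells[OF P(1), of \<delta>] unfolding P(2) sets_m by blast
  \<comment> \<open>Finitely many cells suffice since only the scales up to \<open>n\<close> enter. Discretizing \<open>m\<close> makes the
    bound hold for all functions \<open>f\<close>; the paths of \<open>X\<close> need not be measurable.\<close>
  define \<rho> where "\<rho> k x = r k x + 2 * \<delta>" for k x
  \<comment> \<open>One \<open>\<delta>\<close> passes strictly beyond the infimum; a second one,
    from a point of a cell to its label, gives the \<open>2 * \<delta>\<close> in
    \<open>\<rho>\<close>.\<close>
  define U where "U k x = cball x (r k x + \<delta>)" for k x
  define \<kappa> where "\<kappa> k x v = prob (A v \<inter> U k x) / prob (U k x)" for k x v
  have Usets: "U k x \<in> sets m" for k x by (simp add: U_def)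
  have U: "1 / \<phi> (Y k) \<le> prob (U k x)" for k x
    unfolding U_def using d0 by (intro prob_above_r) simp
  have Upos: "0 < prob (U k x)" for k x
    using U[of k x] phi_Y[of k] by (smt (verit) divide_pos_pos)
  interpret chaining_kernels \<phi> a b Y P "\<lambda>v. prob (A v)" \<rho> \<kappa>
  proof
    fix k x
    have "(\<Sum>v\<in>P. prob (A v \<inter> U k x)) = prob (\<Union>v\<in>P. A v \<inter> U k x)"
      using P(1) A(1,3) Usets
      by (intro finite_measure_finite_Union[symmetric]) (auto simp: disjoint_family_on_def)
    also have "(\<Union>v\<in>P. A v \<inter> U k x) = U k x" using A(4) by blast
    finally show "(\<Sum>v\<in>P. \<kappa> k x v) = 1"
      using Upos[of k x] by (simp add: \<kappa>_def sum_divide_distrib[symmetric])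
  next
    fix k x v assume v: "v \<in> P" "\<kappa> k x v \<noteq> 0"
    then have "A v \<inter> U k x \<noteq> {}" by (auto simp: \<kappa>_def)
    then obtain z where "z \<in> A v" "z \<in> U k x" by blast
    then have "dist v z \<le> \<delta>" "dist x z \<le> r k x + \<delta>"
      using A(2)[OF v(1)] by (auto simp: U_def)
    then show "dist x v \<le> \<rho> k x" using dist_triangle2[of x v z] by (simp add: \<rho>_def)
  next
    fix k x v assume v: "v \<in> P"
    have "\<kappa> k x v \<le> prob (A v) / prob (U k x)"
      unfolding \<kappa>_def using v A(1) by (intro divide_right_mono finite_measure_mono) auto
    also have "\<dots> = prob (A v) * (1 / prob (U k x))" by simp
    also have "\<dots> \<le> prob (A v) * \<phi> (Y k)"
      using U[of k x] Upos[of k x] phi_Y[of k] by (intro mult_left_mono) (auto simp: field_simps)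
    finally show "\<kappa> k x v \<le> \<phi> (Y k) * prob (A v)" by (simp add: mult.commute)
  next
    fix x v assume v: "v \<in> P"
    \<comment> \<open>Since \<open>\<phi> (Y 0) = 1\<close>, the coarsest ball has full mass and
      conditioning on it changes nothing.\<close>
    have U1: "prob (U 0 x) = 1"
      using U[of 0 x] prob_le_1[of "U 0 x"] by (simp add: phi_Y_0)
    have "prob (A v - U 0 x) \<le> prob (space m - U 0 x)"
      using v A(1) Usets by (intro finite_measure_mono sets.compl_sets) (auto simp: space_m)
    also have "\<dots> = 0" using U1 Usets by (simp add: prob_compl)
    finally have "prob (A v - U 0 x) = 0" by (simp add: measure_le_0_iff)
    then have "prob (A v \<inter> U 0 x) = prob (A v)"
      using finite_measure_Diff'[of "A v" "U 0 x"] v A(1) Usets by simp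
    then show "\<kappa> 0 x v = prob (A v)" by (simp add: \<kappa>_def U1)
  next
    show "\<rho> k x \<le> \<rho> k y + dist x y" for k x y
      using r_lipschitz[of k x y] by (simp add: \<rho>_def)
    show "0 \<le> \<rho> k x" for k x using r_nonneg[of k x] d0 by (simp add: \<rho>_def)
    show "x \<le> a + b * (\<phi> (x * Y k) / \<phi> (Y k))" if "0 \<le> x" for x k
      using that by (rule growth)
  qed (auto simp: ab phi_nonneg Y_pos phi_Y P(1) \<kappa>_def)
  let ?C = "R ^ 2 / (R - 1) * S + e"
  have C: "(\<Sum>k\<le>n. Y (Suc k) * \<rho> k x) \<le> ?C" for x
  proof -
    have "(\<Sum>k\<le>n. Y (Suc k) * \<rho> k x) = (\<Sum>k\<le>n. Y (Suc k) * r k x) + Z * (2 * \<delta>)"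
      unfolding \<rho>_def distrib_left sum.distrib Z_def sum_distrib_right ..
    then show ?thesis using sum_Y_r_le[of x n] dZ e0 by linarith
  qed
  have E: "\<forall>x\<in>F. Y (Suc n) * \<rho> n x \<le> e"
  proof
    fix x assume "x \<in> F"
    have "Y (Suc n) * (2 * \<delta>) \<le> e / 2"
      unfolding dZ[symmetric] using YZ d0 by (intro mult_right_mono) auto
    then show "Y (Suc n) * \<rho> n x \<le> e" using n[OF \<open>x \<in> F\<close>] by (simp add: \<rho>_def distrib_left)
  qed
  obtain Q w where Qw: "finite Q" "\<forall>q. 0 \<le> w q" "sum w Q \<le> b * (?C + card F * e)"
    "\<forall>f. \<forall>s\<in>F. \<forall>t\<in>F. \<bar>f s - f t\<bar> / 2 \<le>
       a * ((R - 1) / (R - 2) * ?C + e) + (\<Sum>q\<in>Q. w q * increment \<phi> f q)"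
    using finite_pair_bound[OF R aR Y_Suc F C E less_imp_le[OF e0]] by (elim exE conjE) blast+
  have "b * (?C + card F * e) = b * (R ^ 2 / (R - 1)) * S + b * (1 + card F) * e"
    by (simp add: algebra_simps)
  then have mass: "sum w Q \<le> b * (R ^ 2 / (R - 1)) * S + \<eta>"
    using Qw(3) e1(1) by linarith
  have "a * ((R - 1) / (R - 2) * ?C + e) \<le> a * (R ^ 3 / ((R - 1) * (R - 2))) * S + \<eta>"
  proof (cases "a = 0")
    case False
    then have R2: "R > 2" using aR by simp
    have "a * ((R - 1) / (R - 2) * ?C + e) =
        a * ((R - 1) / (R - 2) * (R ^ 2 / (R - 1))) * S + a * ((R - 1) / (R - 2) + 1) * e"
      by (simp add: algebra_simps)
    also have "(R - 1) / (R - 2) * (R ^ 2 / (R - 1)) = R ^ 2 / (R - 2) * 1"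
      using R2 by simp
    \<comment> \<open>The chaining constant \<open>R^2 / (R - 2)\<close> is enlarged by
      \<open>R / (R - 1) \<ge> 1\<close> to reach the stated form.\<close>
    also have "a * (R ^ 2 / (R - 2) * 1) * S \<le> a * (R ^ 2 / (R - 2) * (R / (R - 1))) * S"
      using R2 ab S(2) by (intro mult_right_mono mult_left_mono) auto
    also have "R ^ 2 / (R - 2) * (R / (R - 1)) = R ^ 3 / ((R - 1) * (R - 2))"
      by (simp add: power2_eq_square power3_eq_cube mult.commute)
    finally show ?thesis using e1(2) by simp
  qed (use eta in simp)
  then have "\<forall>f. \<forall>s\<in>F. \<forall>t\<in>F. \<bar>f s - f t\<bar> / 2 \<le>
       a * (R ^ 3 / ((R - 1) * (R - 2))) * S + \<eta> + (\<Sum>q\<in>Q. w q * increment \<phi> f q)"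
    using Qw(4) by (meson add_right_mono order_trans)
  then show ?thesis using Qw(1,2) mass by (intro exI[of _ Q] exI[of _ w] conjI)
qed

end

subsection \<open>Expectation of the supremum\<close>

text \<open>Precomposition with \<open>max 0\<close> extends \<open>g\<close> continuously to the
  whole line without changing it at the values of \<open>Z\<close>.\<close>

lemma borel_measurable_compose_nonneg:
  fixes g :: "real \<Rightarrow> real"
  assumes "continuous_on {0..} g" "Z \<in> borel_measurable M" "\<And>\<omega>. 0 \<le> Z \<omega>"
  shows "(\<lambda>\<omega>. g (Z \<omega>)) \<in> borel_measurable M"
proof -
  have "continuous_on UNIV (\<lambda>x. g (max 0 x))"
    by (rule continuous_on_compose2[OF assms(1)]) (auto intro!: continuous_intros)
  then have "(\<lambda>x. g (max 0 x)) \<in> borel_measurable borel"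
    by (rule borel_measurable_continuous_onI)
  then have "(\<lambda>\<omega>. g (max 0 (Z \<omega>))) \<in> borel_measurable M"
    using assms(2) by measurable
  then show ?thesis using assms(3) by (simp add: max_def)
qed

text \<open>Applied to \<open>f / x\<close> with \<open>x = \<bar>f s - f t\<bar> / (2 * (\<kappa> + L))\<close>, the hypothesis says that the
  weighted increments of \<open>f / x\<close> add up to at least \<open>L\<close>; the growth condition on \<open>\<psi>\<close> then trades
  \<open>f / x\<close> for \<open>f\<close>.\<close>

lemma psi_le_weighted_increments:
  fixes f :: "'a::metric_space \<Rightarrow> real"
  assumes bound: "\<And>f. \<bar>f s - f t\<bar> / 2 \<le> \<kappa> + (\<Sum>q\<in>Q. w q * increment \<phi> f q)"
    and w: "\<And>q. 0 \<le> w q" and L: "0 < L" and \<kappa>: "0 \<le> \<kappa>"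
    and phi: "\<phi> 0 = 0" "\<And>x. 0 < x \<Longrightarrow> 0 < \<phi> x"
    and psi: "\<psi> 0 = 0" "\<And>x y. 0 \<le> x \<Longrightarrow> 0 < y \<Longrightarrow> \<psi> x \<le> \<alpha> + \<beta> * (\<phi> (x * y) / \<phi> y)"
    and ab: "0 \<le> \<alpha>" "0 \<le> \<beta>"
  shows "\<psi> (\<bar>f s - f t\<bar> / (2 * (\<kappa> + L))) \<le> \<alpha> + \<beta> / L * (\<Sum>q\<in>Q. w q * increment \<phi> f q)"
proof -
  define x where "x = \<bar>f s - f t\<bar> / (2 * (\<kappa> + L))"
  have inc0: "0 \<le> increment \<phi> f q" for q
    using phi by (cases "\<bar>f (fst q) - f (snd q)\<bar> / dist (fst q) (snd q) = 0")
      (auto simp: increment_def less_imp_le)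
  have \<Lambda>0: "0 \<le> \<beta> / L * (\<Sum>q\<in>Q. w q * increment \<phi> f q)"
    using ab L w inc0 by (intro mult_nonneg_nonneg sum_nonneg) auto
  have x0: "0 \<le> x" using L \<kappa> by (simp add: x_def)
  show ?thesis
  \<comment> \<open>Outside this immediate case, \<open>x\<close> can be divided by and
    \<open>\<psi> x - \<alpha>\<close> is a positive multiplier.\<close>
  proof (cases "x = 0 \<or> \<psi> x \<le> \<alpha>")
    case True
    then have "\<psi> x \<le> \<alpha>" using psi(1) ab by auto
    then have "\<psi> x \<le> \<alpha> + \<beta> / L * (\<Sum>q\<in>Q. w q * increment \<phi> f q)" using \<Lambda>0 by linarith
    then show ?thesis unfolding x_def .
  next
    case False
    then have x: "0 < x" "\<alpha> < \<psi> x" using x0 by auto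
    define g where "g u = f u / x" for u
    have "\<bar>g s - g t\<bar> = \<bar>f s - f t\<bar> / x"
      using x(1) by (simp add: g_def diff_divide_distrib[symmetric] abs_divide)
    also have "\<dots> = 2 * (\<kappa> + L)" using x(1) L \<kappa> by (auto simp: x_def field_simps)
    finally have big: "L \<le> (\<Sum>q\<in>Q. w q * increment \<phi> g q)" using bound[of g] by simp
    have point: "(\<psi> x - \<alpha>) * increment \<phi> g q \<le> \<beta> * increment \<phi> f q" for q
    proof -
      define y where "y = \<bar>g (fst q) - g (snd q)\<bar> / dist (fst q) (snd q)"
      have xy: "x * y = \<bar>f (fst q) - f (snd q)\<bar> / dist (fst q) (snd q)"
        using x(1) by (simp add: y_def g_def diff_divide_distrib[symmetric] abs_divide)
      have "(\<psi> x - \<alpha>) * \<phi> y \<le> \<beta> * \<phi> (x * y)"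
      proof (cases "y = 0")
        case False
        then have y: "0 < y" by (simp add: y_def less_le)
        then show ?thesis using psi(2)[OF x0 y] phi(2)[OF y] by (simp add: field_simps)
      qed (simp add: phi)
      then show ?thesis by (simp add: increment_def y_def[symmetric] xy[symmetric])
    qed
    have "(\<psi> x - \<alpha>) * L \<le> (\<psi> x - \<alpha>) * (\<Sum>q\<in>Q. w q * increment \<phi> g q)"
      using big x by (intro mult_left_mono) auto
    also have "\<dots> = (\<Sum>q\<in>Q. w q * ((\<psi> x - \<alpha>) * increment \<phi> g q))"
      by (simp add: sum_distrib_left mult_ac)
    also have "\<dots> \<le> (\<Sum>q\<in>Q. w q * (\<beta> * increment \<phi> f q))"
      using w point by (intro sum_mono mult_left_mono)
    also have "\<dots> = \<beta> * (\<Sum>q\<in>Q. w q * increment \<phi> f q)"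
      by (simp add: sum_distrib_left mult_ac)
    finally have "\<psi> x \<le> \<alpha> + \<beta> / L * (\<Sum>q\<in>Q. w q * increment \<phi> f q)"
      using L by (simp add: field_simps)
    then show ?thesis unfolding x_def .
  qed
qed

lemma SUP_finite_pairs_borel_measurable:
  assumes "finite F" "\<And>s t. g s t \<in> borel_measurable M"
  shows "(\<lambda>\<omega>. SUP s\<in>F. SUP t\<in>F. ennreal (g s t \<omega>)) \<in> borel_measurable M"
  using assms by (intro borel_measurable_SUP countable_finite measurable_compose[OF _ measurable_ennreal]) auto

theorem theorem3p2:
  fixes m :: "'a::metric_space measure"
    and \<phi> \<psi> :: "real \<Rightarrow> real"
    and a b R \<alpha> \<beta> :: real
    and A B K :: ennreal
    and M :: "'w measure"
    and X :: "'a \<Rightarrow> 'w \<Rightarrow> real"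
  assumes "prob_space m" and "sets m = sets borel" and "measure_support m = UNIV"
    and "a \<ge> 0" and "b \<ge> 0" and "\<phi> \<in> growth_class a b"
    and "R \<ge> 2"
    and "A = ennreal (R ^ 3) / ennreal ((R - 1) * (R - 2))"
    and "B = ennreal (R ^ 2) / ennreal (R - 1)"
    and "K = (ennreal a * A + ennreal b * B) * majorizing_integral \<phi> m"
    and "mono_on {0..} \<psi>" and "continuous_on {0..} \<psi>" and "\<psi> 0 = 0"
    and "\<alpha> \<ge> 0" and "\<beta> \<ge> 0"
    and "\<forall>x\<ge>0. \<forall>y>0. \<psi> x \<le> \<alpha> + \<beta> * (\<phi> (x * y) / \<phi> y)"
    and "prob_space M" and "\<forall>t. X t \<in> borel_measurable M" and "separable_process M X"
    and "(SUP s. SUP t. \<integral>\<^sup>+\<omega>. ennreal (\<phi> (\<bar>X s \<omega> - X t \<omega>\<bar> / dist s t)) \<partial>M) \<le> 1"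
  shows "(SUP F\<in>{F. finite F}. \<integral>\<^sup>+\<omega>. (SUP s\<in>F. SUP t\<in>F.
            ennreal (\<psi> (enn2real (ennreal \<bar>X s \<omega> - X t \<omega>\<bar> / (2 * K))))) \<partial>M)
         \<le> ennreal (\<alpha> + \<beta>)"
proof (cases "K = 0 \<or> K = top")
  case True
  \<comment> \<open>An infinite \<open>K\<close> makes the quotient 0; for \<open>K = 0\<close> it
    is 0 or \<open>top\<close>, and \<open>enn2real\<close> sends \<open>top\<close> to 0.\<close>
  then have "enn2real (ennreal \<bar>y\<bar> / (2 * K)) = 0" for y
    by (cases "y = 0") (auto simp: ennreal_mult_top ennreal_top_mult ennreal_divide_zero)
  then have "(SUP s\<in>F. SUP t\<in>F. ennreal (\<psi> (enn2real (ennreal \<bar>X s \<omega> - X t \<omega>\<bar> / (2 * K))))) = 0" for F \<omega>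
    by (simp add: assms(13) flip: bot_ennreal)
  then show ?thesis by (intro SUP_least) simp
next
  case False
  interpret M: prob_space M by fact
  let ?I = "majorizing_integral \<phi> m"
  have I0: "?I \<noteq> 0" using False assms(10) by auto
  have Itop: "?I \<noteq> top"
    using False assms(10) by (auto simp: ennreal_mult_top)
  define S where "S = enn2real ?I"
  have S: "?I = ennreal S" "0 \<le> S" using Itop by (auto simp: S_def less_top)
  \<comment> \<open>For \<open>R = 2\<close> the constant \<open>A\<close> is infinite, so
    \<open>a > 0\<close> would give \<open>K = top\<close>.\<close>
  have aR: "a = 0 \<or> R > 2"
  proof (rule ccontr)
    assume "\<not> ?thesis"
    then have "a > 0" "R = 2" using assms(4,7) by auto
    then have "K = top"
      using I0 by (simp add: assms(8,10) ennreal_mult_top ennreal_top_mult)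
    then show False using False by simp
  qed
  interpret majorizing_measure m \<phi> a b R S
    using assms(1-7) S by (simp add: majorizing_measure_def majorizing_measure_axioms_def)
  define k\<^sub>1 where "k\<^sub>1 = a * (R ^ 3 / ((R - 1) * (R - 2))) * S"
  define k\<^sub>2 where "k\<^sub>2 = b * (R ^ 2 / (R - 1)) * S"
  have k0: "0 \<le> k\<^sub>1" "0 \<le> k\<^sub>2" using ab R S(2) by (auto simp: k\<^sub>1_def k\<^sub>2_def)
  \<comment> \<open>If \<open>a = 0\<close>, both sides are 0 even when \<open>A\<close> is
    infinite.\<close>
  have "ennreal a * A = ennreal (a * (R ^ 3 / ((R - 1) * (R - 2))))"
  proof (cases "a = 0")
    case False
    then have "A = ennreal (R ^ 3 / ((R - 1) * (R - 2)))"
      unfolding assms(8) using aR by (intro divide_ennreal) auto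
    then show ?thesis using ab R by (simp only: ennreal_mult')
  qed simp
  moreover have "ennreal b * B = ennreal (b * (R ^ 2 / (R - 1)))"
  proof -
    have "B = ennreal (R ^ 2 / (R - 1))"
      unfolding assms(9) using R by (intro divide_ennreal) auto
    then show ?thesis using ab by (simp only: ennreal_mult')
  qed
  ultimately have "K = ennreal k\<^sub>1 + ennreal k\<^sub>2"
    unfolding assms(10) k\<^sub>1_def k\<^sub>2_def S(1) by (simp only: distrib_right ennreal_mult''[OF S(2)])
  then have K: "K = ennreal (k\<^sub>1 + k\<^sub>2)" using k0 by simp
  then have kpos: "0 < k\<^sub>1 + k\<^sub>2" using False k0 by (auto simp: less_le)
  \<comment> \<open>The pair bound is only available with a slack \<open>\<eta>\<close> in each of
    \<open>k\<^sub>1\<close> and \<open>k\<^sub>2\<close>, hence \<open>2 * \<eta>\<close> in the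
    denominator.\<close>
  define h where "h \<eta> s t \<omega> = \<psi> (\<bar>X s \<omega> - X t \<omega>\<bar> / (2 * (k\<^sub>1 + k\<^sub>2 + 2 * \<eta>)))" for \<eta> s t \<omega>
  have hK: "\<psi> (enn2real (ennreal \<bar>X s \<omega> - X t \<omega>\<bar> / (2 * K))) = h 0 s t \<omega>" for s t \<omega>
  proof -
    have "2 * K = ennreal (2 * (k\<^sub>1 + k\<^sub>2))"
      unfolding K using kpos by (subst ennreal_mult) auto
    then have "ennreal \<bar>X s \<omega> - X t \<omega>\<bar> / (2 * K) = ennreal (\<bar>X s \<omega> - X t \<omega>\<bar> / (2 * (k\<^sub>1 + k\<^sub>2)))"
      using kpos by (simp only:) (intro divide_ennreal, auto)
    then show ?thesis using kpos k0 by (simp add: h_def)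
  qed
  have X[measurable]: "X t \<in> borel_measurable M" for t using assms(18) by simp
  have h_meas: "h \<eta> s t \<in> borel_measurable M" if "0 \<le> \<eta>" for \<eta> s t
    unfolding h_def using that kpos
    by (intro borel_measurable_compose_nonneg[OF assms(12)]) auto
  have inc_meas: "(\<lambda>\<omega>. increment \<phi> (\<lambda>u. X u \<omega>) q) \<in> borel_measurable M" for q
    unfolding increment_def using phi
    by (intro borel_measurable_compose_nonneg[where g = \<phi>]) (auto simp: growth_class_def)
  have inc_int: "(\<integral>\<^sup>+\<omega>. ennreal (increment \<phi> (\<lambda>u. X u \<omega>) q) \<partial>M) \<le> 1" for q
  proof -
    let ?J = "\<lambda>s t. \<integral>\<^sup>+\<omega>. ennreal (\<phi> (\<bar>X s \<omega> - X t \<omega>\<bar> / dist s t)) \<partial>M"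
    have "?J (fst q) (snd q) \<le> (SUP t. ?J (fst q) t)" by (rule SUP_upper) simp
    also have "\<dots> \<le> (SUP s. SUP t. ?J s t)" by (rule SUP_upper) simp
    also have "\<dots> \<le> 1" by (rule assms(20))
    finally show ?thesis by (simp add: increment_def)
  qed
  have inc0: "0 \<le> increment \<phi> f q" for f :: "'a \<Rightarrow> real" and q
    unfolding increment_def by (intro phi_nonneg) auto
  have step: "(\<integral>\<^sup>+\<omega>. (SUP s\<in>F. SUP t\<in>F. ennreal (h \<eta> s t \<omega>)) \<partial>M) \<le> ennreal (\<alpha> + \<beta>)"
    if F: "finite F" and eta: "0 < \<eta>" for F \<eta>
  proof -
    obtain Q w where Qw: "finite Q" "\<forall>q. 0 \<le> w q" "sum w Q \<le> k\<^sub>2 + \<eta>"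
      and bound: "\<forall>f. \<forall>s\<in>F. \<forall>t\<in>F.
         \<bar>f s - f t\<bar> / 2 \<le> k\<^sub>1 + \<eta> + (\<Sum>q\<in>Q. w q * increment \<phi> f q)"
      using majorizing_pair_bound[OF aR F eta] unfolding k\<^sub>1_def[symmetric] k\<^sub>2_def[symmetric]
      by (elim exE conjE) blast+
    have w: "0 \<le> w q" for q using Qw(2) by blast
    \<comment> \<open>\<open>L\<close> bounds the mass of \<open>w\<close>, and each increment has
      expectation at most 1, so the factor \<open>\<beta> / L\<close> leaves at most
      \<open>\<beta>\<close>.\<close>
    define L where "L = k\<^sub>2 + \<eta>"
    have L: "0 < L" using k0 eta by (simp add: L_def)
    have point: "h \<eta> s t \<omega> \<le> \<alpha> + \<beta> / L * (\<Sum>q\<in>Q. w q * increment \<phi> (\<lambda>u. X u \<omega>) q)"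
      if "s \<in> F" "t \<in> F" for s t \<omega>
    proof -
      have "\<psi> (\<bar>X s \<omega> - X t \<omega>\<bar> / (2 * (k\<^sub>1 + \<eta> + L)))
          \<le> \<alpha> + \<beta> / L * (\<Sum>q\<in>Q. w q * increment \<phi> (\<lambda>u. X u \<omega>) q)"
      proof (rule psi_le_weighted_increments[where f = "\<lambda>u. X u \<omega>"])
        show "\<bar>f s - f t\<bar> / 2 \<le> k\<^sub>1 + \<eta> + (\<Sum>q\<in>Q. w q * increment \<phi> f q)" for f
          using bound that by blast
      qed (use w L k0 eta phi_0 phi_pos assms(13-16) in auto)
      moreover have "k\<^sub>1 + \<eta> + L = k\<^sub>1 + k\<^sub>2 + 2 * \<eta>" by (simp add: L_def)
      ultimately show ?thesis by (simp add: h_def)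
    qed
    have "(\<integral>\<^sup>+\<omega>. (SUP s\<in>F. SUP t\<in>F. ennreal (h \<eta> s t \<omega>)) \<partial>M)
        \<le> (\<integral>\<^sup>+\<omega>. ennreal (\<alpha> + \<beta> / L * (\<Sum>q\<in>Q. w q * increment \<phi> (\<lambda>u. X u \<omega>) q)) \<partial>M)"
      by (intro nn_integral_mono SUP_least ennreal_leI point)
    also have "\<dots> = (\<integral>\<^sup>+\<omega>. ennreal \<alpha> + ennreal (\<beta> / L) *
        (\<Sum>q\<in>Q. ennreal (w q) * ennreal (increment \<phi> (\<lambda>u. X u \<omega>) q)) \<partial>M)"
      using assms(14,15) L w inc0
      by (simp add: ennreal_mult[symmetric] sum_ennreal sum_nonneg flip: ennreal_plus)
    also have "\<dots> = ennreal \<alpha> + ennreal (\<beta> / L) *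
        (\<Sum>q\<in>Q. ennreal (w q) * (\<integral>\<^sup>+\<omega>. ennreal (increment \<phi> (\<lambda>u. X u \<omega>) q) \<partial>M))"
      using inc_meas
      by (simp add: nn_integral_add nn_integral_cmult nn_integral_sum M.emeasure_space_1)
    also have "\<dots> \<le> ennreal \<alpha> + ennreal (\<beta> / L) * (\<Sum>q\<in>Q. ennreal (w q) * 1)"
      by (intro add_left_mono mult_left_mono sum_mono inc_int) auto
    also have "\<dots> = ennreal (\<alpha> + \<beta> / L * sum w Q)"
      using assms(14,15) L w
      by (simp add: sum_ennreal ennreal_mult[symmetric] sum_nonneg flip: ennreal_plus)
    also have "\<dots> \<le> ennreal (\<alpha> + \<beta> / L * L)"
      using assms(15) L Qw(3) by (intro ennreal_leI add_left_mono mult_left_mono) (auto simp: L_def)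
    finally show ?thesis using L by simp
  qed
  have "(\<integral>\<^sup>+\<omega>. (SUP s\<in>F. SUP t\<in>F. ennreal (h 0 s t \<omega>)) \<partial>M) \<le> ennreal (\<alpha> + \<beta>)"
    if F: "finite F" for F
  proof -
    \<comment> \<open>The slack is removed by monotone convergence: as \<open>e n\<close> decreases
      to 0 the quotients grow, and \<open>\<psi>\<close> is increasing and continuous.\<close>
    define e where "e n = 1 / real (Suc n)" for n
    define u where "u n \<omega> = (SUP s\<in>F. SUP t\<in>F. ennreal (h (e n) s t \<omega>))" for n \<omega>
    have e: "0 < e n" "e (Suc n) \<le> e n" for n by (auto simp: e_def field_simps)
    have "e \<longlonglongrightarrow> 0" unfolding e_def using LIMSEQ_inverse_real_of_nat by (simp add: inverse_eq_divide)
    have lim: "(\<lambda>n. h (e n) s t \<omega>) \<longlonglongrightarrow> h 0 s t \<omega>" for s t \<omega>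
    proof -
      have "(\<lambda>n. \<bar>X s \<omega> - X t \<omega>\<bar> / (2 * (k\<^sub>1 + k\<^sub>2 + 2 * e n)))
          \<longlonglongrightarrow> \<bar>X s \<omega> - X t \<omega>\<bar> / (2 * (k\<^sub>1 + k\<^sub>2 + 2 * 0))"
        using kpos by (intro tendsto_intros \<open>e \<longlonglongrightarrow> 0\<close>) auto
      then show ?thesis
        unfolding h_def using kpos e(1)
        by (intro continuous_on_tendsto_compose[OF assms(12)]) (auto simp: less_imp_le add_nonneg_nonneg)
    qed
    have mono: "h (e n) s t \<omega> \<le> h (e (Suc n)) s t \<omega>" for n s t \<omega>
      unfolding h_def using kpos e(1)[of n] e(1)[of "Suc n"] e(2)[of n]
      by (intro mono_onD[OF assms(11)] divide_left_mono mult_pos_pos) auto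
    have "(\<integral>\<^sup>+\<omega>. (SUP s\<in>F. SUP t\<in>F. ennreal (h 0 s t \<omega>)) \<partial>M) \<le> (\<integral>\<^sup>+\<omega>. (SUP n. u n \<omega>) \<partial>M)"
    proof (intro nn_integral_mono SUP_least)
      fix \<omega> s t assume st: "s \<in> F" "t \<in> F"
      have le: "ennreal (h (e n) s t \<omega>) \<le> (SUP n. u n \<omega>)" for n
      proof -
        have "ennreal (h (e n) s t \<omega>) \<le> (SUP t\<in>F. ennreal (h (e n) s t \<omega>))"
          using st(2) by (rule SUP_upper)
        also have "\<dots> \<le> u n \<omega>" unfolding u_def using st(1) by (rule SUP_upper)
        also have "\<dots> \<le> (SUP n. u n \<omega>)" by (rule SUP_upper) simp
        finally show ?thesis .
      qed
      show "ennreal (h 0 s t \<omega>) \<le> (SUP n. u n \<omega>)"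
        by (rule LIMSEQ_le_const2[OF tendsto_ennrealI[OF lim]]) (use le in blast)
    qed
    also have "\<dots> = (SUP n. \<integral>\<^sup>+\<omega>. u n \<omega> \<partial>M)"
    proof (rule nn_integral_monotone_convergence_SUP)
      show "incseq u"
        unfolding u_def by (intro incseq_SucI le_funI SUP_mono' ennreal_leI mono)
      show "u n \<in> borel_measurable M" for n
        unfolding u_def using F h_meas[OF less_imp_le[OF e(1)]]
        by (intro SUP_finite_pairs_borel_measurable)
    qed
    also have "\<dots> \<le> ennreal (\<alpha> + \<beta>)"
      unfolding u_def by (intro SUP_least step F e)
    finally show ?thesis .
  qed
  then show ?thesis unfolding hK by (intro SUP_least) auto
qed

end
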